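(* Let $D\colon\mathbb R^S\to\mathbb R^N$ be a linear operator, $v\in\mathbb R^N$, $\lambda>0$, and let $g\in\Gamma_0(\mathbb R^S)$, with $g_\lambda=\lambda g$. Let $z^\dagger_D\in\mathbb R^S$ be a minimizer over $z\in\mathbb R^S$ of $\frac12\|Dz-v\|^2+g_\lambda(z)$, and let $x^\dagger_D=Dz^\dagger_D$. Then $$x^\dagger_D=Dz^\dagger_D=\operatorname{prox}_{(g_\lambda^*\circ D^* )^*}(v)=\operatorname{prox}_{D\rhd g_\lambda}(v).$$
   Context: $\Gamma_0(\mathbb R^S)$ is the set of proper, lower semi-continuous, convex functions from $\mathbb R^S$ to $(-\infty,+\infty]$. $h^*$ denotes the Fenchel–Legendre conjugate $h^*(u)=\sup_x\langle u,x\rangle-h(x)$, and $D^*$ the adjoint of $D$. $\operatorname{prox}_h(v)=\operatorname{argmin}_{x\in\mathbb R^N}h(x)+\frac12\|x-v\|^2$ (the unique minimizer). The infimal post-composition of $g_\lambda$ by $D$ is $D\rhd g_\lambda\colon\mathbb R^N\to[-\infty,+\infty]\colon x\mapsto\inf_{z\in\mathbb R^S,\ x=Dz}g_\lambda(z)$, equal to $+\infty$ when $\{z\in\mathbb R^S\mid x=Dz\}$ is empty. *)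

theory Defs
  imports "HOL-Analysis.Analysis"
begin

definition lsc :: "('a::topological_space \<Rightarrow> ereal) \<Rightarrow> bool" where
  "lsc f \<longleftrightarrow> (\<forall>x. f x \<le> Liminf (at x) f)"

definition proper :: "('a \<Rightarrow> ereal) \<Rightarrow> bool" where
  "proper f \<longleftrightarrow> (\<forall>x. f x \<noteq> -\<infinity>) \<and> (\<exists>x. f x \<noteq> \<infinity>)"

(* Intended for functions that avoid -\<infinity>, where the right-hand side is never \<infinity> - \<infinity>. *)
definition ereal_convex :: "('a::real_vector \<Rightarrow> ereal) \<Rightarrow> bool" where
  "ereal_convex f \<longleftrightarrow>
    (\<forall>x y t. 0 < t \<and> t < 1 \<longrightarrow>
      f ((1 - t) *\<^sub>R x + t *\<^sub>R y) \<le> ereal (1 - t) * f x + ereal t * f y)"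

definition Gamma0 :: "('a::real_normed_vector \<Rightarrow> ereal) set" where
  "Gamma0 = {f. proper f \<and> lsc f \<and> ereal_convex f}"

definition conjugate :: "('a::real_inner \<Rightarrow> ereal) \<Rightarrow> 'a \<Rightarrow> ereal" where
  "conjugate h u = (SUP x. ereal (u \<bullet> x) - h x)"

definition minimizer :: "('a \<Rightarrow> ereal) \<Rightarrow> 'a \<Rightarrow> bool" where
  "minimizer f x \<longleftrightarrow> is_arg_min f (\<lambda>_. True) x"

definition prox_objective :: "('a::real_normed_vector \<Rightarrow> ereal) \<Rightarrow> 'a \<Rightarrow> 'a \<Rightarrow> ereal" where
  "prox_objective h v x = h x + ereal (1/2 * (norm (x - v))\<^sup>2)"

(* The proximal point is meaningful only if the minimizer exists and is unique. Since THE is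
   total, an equation x = prox h v carries this information only together with
   prox_well_defined h v. *)
definition prox_well_defined :: "('a::real_normed_vector \<Rightarrow> ereal) \<Rightarrow> 'a \<Rightarrow> bool" where
  "prox_well_defined h v \<longleftrightarrow> (\<exists>!x. minimizer (prox_objective h v) x)"

definition prox :: "('a::real_normed_vector \<Rightarrow> ereal) \<Rightarrow> 'a \<Rightarrow> 'a" where
  "prox h v = (THE x. minimizer (prox_objective h v) x)"

(* An empty fibre gives \<infinity>, the infimum of the empty set in ereal. *)
definition inf_postcomp :: "('a \<Rightarrow> 'b) \<Rightarrow> ('a \<Rightarrow> ereal) \<Rightarrow> 'b \<Rightarrow> ereal" where
  "inf_postcomp D f x = (INF z\<in>{z. x = D z}. f z)"

end

theory Submission
  imports Defs
begin

text \<open>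
  Put \<open>w = v - D z\<close>. First-order optimality of \<open>z\<close> says that \<open>D\<^sup>* w\<close> is a subgradient of \<open>g\<^sub>\<lambda>\<close> at \<open>z\<close>.
  Hence both the infimal post-composition and \<open>(g\<^sub>\<lambda>\<^sup>* \<circ> D\<^sup>*)\<^sup>*\<close> lie above the affine function
  \<open>g\<^sub>\<lambda> z + \<langle>w, \<cdot> - D z\<rangle>\<close> and are at most \<open>g\<^sub>\<lambda> z\<close> at \<open>D z\<close>. A function with these two properties has \<open>D z\<close>
  as its unique proximal point at \<open>v\<close>, because after adding the quadratic the affine
  minorant turns into a constant plus half the squared distance to \<open>D z\<close>.
\<close>

lemma minimizer_iff: "minimizer f x \<longleftrightarrow> (\<forall>y. f x \<le> f y)"
  for f :: "'a \<Rightarrow> ereal"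
  by (auto simp: minimizer_def is_arg_min_def not_less)

lemma norm_add_scaleR_sq:
  "(norm (a + t *\<^sub>R d))\<^sup>2 = (norm a)\<^sup>2 + 2 * t * (a \<bullet> d) + t\<^sup>2 * (norm d)\<^sup>2"
  for a d :: "'a::real_inner"
  unfolding power2_norm_eq_inner
  by (simp add: inner_add_left inner_add_right inner_commute[of d a] power2_eq_square algebra_simps)

text \<open>Letting \<open>t\<close> tend to 0 from the right removes the second-order term; this
  replaces a directional derivative in the optimality argument.\<close>

lemma nonneg_if_nonneg_near_zero:
  fixes a b :: real
  assumes "\<And>t. 0 < t \<Longrightarrow> t < 1 \<Longrightarrow> 0 \<le> a + t * b"
  shows "0 \<le> a"
proof (rule tendsto_lowerbound)
  have "((\<lambda>t. a + t * b) \<longlongrightarrow> a + 0 * b) (at_right 0)"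
    by (intro tendsto_intros)
  then show "((\<lambda>t. a + t * b) \<longlongrightarrow> a) (at_right 0)"
    by simp
  show "\<forall>\<^sub>F t in at_right 0. 0 \<le> a + t * b"
    using assms by (auto simp: eventually_at_right_field intro!: exI[of _ 1])
qed simp

text \<open>Compare \<open>z\<close> with points on the segment towards \<open>y\<close>: convexity
  bounds \<open>f\<close> there and the quadratic expands exactly, so dividing by \<open>t\<close>
  and letting it tend to 0 gives the inequality.\<close>

lemma minimizer_least_squares_subgradient:
  fixes D :: "'a::real_vector \<Rightarrow> 'b::real_inner"
  assumes "linear D" and "ereal_convex f" and fz: "f z = ereal c"
    and "minimizer (\<lambda>y. ereal (1/2 * (norm (D y - v))\<^sup>2) + f y) z"
  shows "ereal (c + (v - D z) \<bullet> (D y - D z)) \<le> f y"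
proof -
  define a where "a = D z - v"
  define d where "d = D y - D z"
  have segment: "ereal (1/2 * (norm a)\<^sup>2 + c)
      \<le> ereal (1/2 * (norm (a + t *\<^sub>R d))\<^sup>2) + (ereal (1 - t) * ereal c + ereal t * f y)"
    if "0 < t" "t < 1" for t
  proof -
    let ?p = "(1 - t) *\<^sub>R z + t *\<^sub>R y"
    have D: "D ?p - v = a + t *\<^sub>R d"
      by (simp add: linear_add[OF assms(1)] linear_diff[OF assms(1)] linear_scale[OF assms(1)] a_def d_def algebra_simps)
    have "ereal (1/2 * (norm a)\<^sup>2) + f z \<le> ereal (1/2 * (norm (D ?p - v))\<^sup>2) + f ?p"
      using assms(4) by (auto simp: minimizer_iff a_def)
    also have "f ?p \<le> ereal (1 - t) * f z + ereal t * f y"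
      using assms(2) that by (auto simp: ereal_convex_def)
    finally show ?thesis
      by (simp add: D fz add_left_mono)
  qed
  show ?thesis
  proof (cases "f y")
    case (real b)
    have "0 \<le> (a \<bullet> d + b - c) + t * (1/2 * (norm d)\<^sup>2)" if t: "0 < t" "t < 1" for t
    proof -
      have "1/2 * (norm a)\<^sup>2 + c \<le> 1/2 * (norm (a + t *\<^sub>R d))\<^sup>2 + ((1 - t) * c + t * b)"
        using segment[OF t] by (simp add: real)
      \<comment> \<open>The zeroth-order terms cancel, leaving a common factor
        \<open>t\<close>.\<close>
      then have "0 \<le> t * ((a \<bullet> d + b - c) + t * (1/2 * (norm d)\<^sup>2))"
        unfolding norm_add_scaleR_sq by (simp add: power2_eq_square algebra_simps)
      then show ?thesis
        using t by (simp add: zero_le_mult_iff)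
    qed
    then have "0 \<le> a \<bullet> d + b - c"
      by (rule nonneg_if_nonneg_near_zero)
    moreover have "(v - D z) \<bullet> (D y - D z) = - (a \<bullet> d)"
      by (simp add: a_def d_def flip: inner_minus_left)
    ultimately show ?thesis
      by (simp add: real)
  next
    case PInf
    then show ?thesis by simp
  next
    \<comment> \<open>Here the right-hand side of \<open>segment\<close> would be
      \<open>-\<infinity>\<close> while its left-hand side is finite.\<close>
    case MInf
    then show ?thesis
      using segment[of "1/2"] by simp
  qed
qed

text \<open>The hypotheses force \<open>h p = c\<close> and make \<open>v - p\<close> a subgradient
  of \<open>h\<close> at \<open>p\<close>, which is the optimality condition for a proximal
  point.\<close>

lemma minimizer_prox_objective_iff:
  fixes h :: "'a::real_inner \<Rightarrow> ereal"
  assumes upper: "h p \<le> ereal c"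
    and minorant: "\<And>x. ereal (c + (v - p) \<bullet> (x - p)) \<le> h x"
  shows "minimizer (prox_objective h v) x \<longleftrightarrow> x = p"
proof -
  \<comment> \<open>The value of the prox objective at \<open>p\<close>.\<close>
  define m where "m = c + 1/2 * (norm (p - v))\<^sup>2"
  have lower: "ereal (m + 1/2 * (norm (y - p))\<^sup>2) \<le> prox_objective h v y" for y
  proof -
    \<comment> \<open>Expanding around \<open>p\<close>, the cross term cancels the slope of the
      affine minorant.\<close>
    have "(norm (y - v))\<^sup>2 = (norm (p - v))\<^sup>2 - 2 * ((v - p) \<bullet> (y - p)) + (norm (y - p))\<^sup>2"
      using norm_add_scaleR_sq[of "p - v" 1 "y - p"]
      by (simp flip: inner_minus_left)
    then have "ereal (m + 1/2 * (norm (y - p))\<^sup>2)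
        = ereal (c + (v - p) \<bullet> (y - p)) + ereal (1/2 * (norm (y - v))\<^sup>2)"
      by (simp add: m_def field_simps)
    also have "\<dots> \<le> prox_objective h v y"
      unfolding prox_objective_def by (intro add_right_mono minorant)
    finally show ?thesis .
  qed
  have at_p: "prox_objective h v p \<le> ereal m"
    using add_right_mono[OF upper, of "ereal (1/2 * (norm (p - v))\<^sup>2)"]
    by (simp add: prox_objective_def m_def)
  show ?thesis
  proof
    assume "minimizer (prox_objective h v) x"
    then have "ereal (m + 1/2 * (norm (x - p))\<^sup>2) \<le> ereal m"
      using lower[of x] at_p by (meson minimizer_iff order_trans)
    then show "x = p"
      by simp
  next
    assume "x = p"
    moreover have "ereal m \<le> prox_objective h v y" for y
      using lower[of y] by (rule order_trans[rotated]) simp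
    ultimately show "minimizer (prox_objective h v) x"
      using at_p by (meson minimizer_iff order_trans)
  qed
qed

lemma prox_eqI:
  assumes "\<And>x. minimizer (prox_objective h v) x \<longleftrightarrow> x = p"
  shows "prox_well_defined h v" and "prox h v = p"
  using assms by (simp_all add: prox_well_defined_def prox_def)

text \<open>A bound at the points \<open>D y\<close> suffices, since an empty fibre gives the value
  \<open>\<infinity>\<close>.\<close>

lemma inf_postcomp_minorant:
  assumes "\<And>y. a (D y) \<le> f y"
  shows "a x \<le> inf_postcomp D f x"
  using assms by (auto simp: inf_postcomp_def intro: INF_greatest)

lemma inf_postcomp_le: "inf_postcomp D f (D z) \<le> f z"
  by (auto simp: inf_postcomp_def intro: INF_lower)

text \<open>The affine minorant bounds \<open>conjugate f\<close> at \<open>adjoint D w\<close> by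
  \<open>w \<bullet> p - c\<close>; the term at \<open>w\<close> of the outer supremum then gives
  the claim.\<close>

lemma conjugate_comp_adjoint_minorant:
  fixes D :: "'a::euclidean_space \<Rightarrow> 'b::euclidean_space"
  assumes "linear D" and "\<And>y. ereal (c + w \<bullet> (D y - p)) \<le> f y"
  shows "ereal (c + w \<bullet> (x - p)) \<le> conjugate (conjugate f \<circ> adjoint D) x"
proof -
  have "ereal (adjoint D w \<bullet> y) - f y \<le> ereal (w \<bullet> p - c)" for y
    using assms(2)[of y]
    by (cases "f y") (simp_all add: adjoint_clauses[OF assms(1)] inner_diff_right algebra_simps)
  then have "conjugate f (adjoint D w) \<le> ereal (w \<bullet> p - c)"
    unfolding conjugate_def by (intro SUP_least)
  then have "ereal (x \<bullet> w) - ereal (w \<bullet> p - c) \<le> ereal (x \<bullet> w) - (conjugate f \<circ> adjoint D) w"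
    by (intro ereal_minus_mono) simp_all
  also have "\<dots> \<le> conjugate (conjugate f \<circ> adjoint D) x"
    unfolding conjugate_def[of "conjugate f \<circ> adjoint D"] by (intro SUP_upper) simp
  finally show ?thesis
    by (simp add: inner_diff_right inner_commute algebra_simps)
qed

text \<open>By the Fenchel-Young inequality at \<open>z\<close>, every term of the outer supremum is
  at most \<open>c\<close>.\<close>

lemma conjugate_comp_adjoint_le:
  fixes D :: "'a::euclidean_space \<Rightarrow> 'b::euclidean_space"
  assumes "linear D" and "f z = ereal c"
  shows "conjugate (conjugate f \<circ> adjoint D) (D z) \<le> ereal c"
  unfolding conjugate_def[of "conjugate f \<circ> adjoint D"]
proof (intro SUP_least)
  fix u
  have "ereal (adjoint D u \<bullet> z) - f z \<le> conjugate f (adjoint D u)"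
    unfolding conjugate_def by (intro SUP_upper) simp
  then have "ereal (D z \<bullet> u - c) \<le> (conjugate f \<circ> adjoint D) u"
    using adjoint_works[OF assms(1), of z u] assms(2) by (simp add: inner_commute)
  then show "ereal (D z \<bullet> u) - (conjugate f \<circ> adjoint D) u \<le> ereal c"
    by (cases "(conjugate f \<circ> adjoint D) u") (simp_all add: algebra_simps)
qed

lemma ereal_convex_cmult:
  assumes "0 \<le> l" and "ereal_convex f"
  shows "ereal_convex (\<lambda>y. ereal l * f y)"
  unfolding ereal_convex_def
proof (intro allI impI, elim conjE)
  fix x y t
  assume t: "0 < t" "t < (1::real)"
  have "ereal l * f ((1 - t) *\<^sub>R x + t *\<^sub>R y) \<le> ereal l * (ereal (1 - t) * f x + ereal t * f y)"
    using assms t by (intro ereal_mult_left_mono) (auto simp: ereal_convex_def)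
  \<comment> \<open>Distributivity is safe in \<open>ereal\<close> because the factor is finite and
    nonnegative.\<close>
  also have "\<dots> = ereal (1 - t) * (ereal l * f x) + ereal t * (ereal l * f y)"
    by (simp add: ereal_pos_distrib assms(1) mult.left_commute)
  finally show "ereal l * f ((1 - t) *\<^sub>R x + t *\<^sub>R y)
      \<le> ereal (1 - t) * (ereal l * f x) + ereal t * (ereal l * f y)" .
qed

lemma proper_cmult:
  assumes "0 < l" and "proper f"
  shows "proper (\<lambda>y. ereal l * f y)"
  using assms by (auto simp: proper_def ereal_mult_eq_MInfty ereal_mult_eq_PInfty)

text \<open>A proper function has a point where the objective is below \<open>\<infinity>\<close>,
  so its value at a minimizer is too; this supplies the real constant of the affine
  minorant.\<close>

lemma minimizer_proper_finite:
  assumes "proper f" and "minimizer (\<lambda>y. ereal (q y) + f y) z"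
  obtains c where "f z = ereal c"
proof -
  obtain y where "f y \<noteq> \<infinity>"
    using assms(1) by (auto simp: proper_def)
  moreover have "ereal (q z) + f z \<le> ereal (q y) + f y"
    using assms(2) by (auto simp: minimizer_iff)
  ultimately have "f z \<noteq> \<infinity>"
    by (cases "f y") auto
  moreover have "f z \<noteq> -\<infinity>"
    using assms(1) by (auto simp: proper_def)
  ultimately show thesis
    using that by (cases "f z") auto
qed

theorem proposition3p1:
  fixes D :: "real ^ 's \<Rightarrow> real ^ 'n"
    and v x :: "real ^ 'n"
    and z :: "real ^ 's"
    and l :: real
    and g gl :: "real ^ 's \<Rightarrow> ereal"
  assumes "linear D"
    and "l > 0"
    and "g \<in> Gamma0"
    and "gl = (\<lambda>y. ereal l * g y)"
    and "minimizer (\<lambda>y. ereal (1/2 * (norm (D y - v))\<^sup>2) + gl y) z"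
    and "x = D z"
  shows "prox_well_defined (conjugate (conjugate gl \<circ> adjoint D)) v
    \<and> prox_well_defined (inf_postcomp D gl) v
    \<and> x = D z
    \<and> D z = prox (conjugate (conjugate gl \<circ> adjoint D)) v
    \<and> prox (conjugate (conjugate gl \<circ> adjoint D)) v = prox (inf_postcomp D gl) v"
proof -
  have "proper gl" and convex: "ereal_convex gl"
    using assms by (simp_all add: Gamma0_def proper_cmult ereal_convex_cmult)
  obtain c where c: "gl z = ereal c"
    using \<open>proper gl\<close> assms(5) by (rule minimizer_proper_finite)
  have subgradient: "ereal (c + (v - D z) \<bullet> (D y - D z)) \<le> gl y" for y
    using assms(1) convex c assms(5) by (rule minimizer_least_squares_subgradient)
  have "minimizer (prox_objective (conjugate (conjugate gl \<circ> adjoint D)) v) y \<longleftrightarrow> y = D z" for y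
    using conjugate_comp_adjoint_le[where f = gl, OF assms(1) c]
      conjugate_comp_adjoint_minorant[OF assms(1) subgradient]
    by (rule minimizer_prox_objective_iff)
  note conj = prox_eqI[OF this]
  have "minimizer (prox_objective (inf_postcomp D gl) v) y \<longleftrightarrow> y = D z" for y
  proof (rule minimizer_prox_objective_iff)
    show "inf_postcomp D gl (D z) \<le> ereal c"
      using inf_postcomp_le[of D gl z] by (simp add: c)
    show "ereal (c + (v - D z) \<bullet> (x - D z)) \<le> inf_postcomp D gl x" for x
      by (rule inf_postcomp_minorant[where a = "\<lambda>x. ereal (c + (v - D z) \<bullet> (x - D z))"])
        (rule subgradient)
  qed
  note post = prox_eqI[OF this]
  show ?thesis
    using conj post assms(6) by simp
qed

end
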